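(* Let $f$ and $V_p$ be as fixed in the context (in particular $f$ satisfies the homogeneous dominance assumption). Let $N_\theta:\mathbb R^n\to\mathbb R$ be a fully connected feedforward network with tanh activations and parameter vector $\theta$, and define $$G_\theta(x)=N_\theta(x)-N_\theta(0),\qquad H_\theta(x)=V_p(x)e^{G_\theta(x)},\qquad W_\theta(x)=\tanh H_\theta(x).$$ Then, for every parameter vector $\theta$, the functions $H_\theta$ and $W_\theta$ are strict Lyapunov functions for $\dot x=f(x)$ on some neighborhood of the origin.
   Context: Setting. $f\in C^1(\mathbb R^n;\mathbb R^n)$ with $f(0)=0$. For differentiable $V$, $\mathcal L_fV(x)=DV(x)f(x)$. $\|\cdot\|$ is the Euclidean norm. A map $g$ is homogeneous of degree $s$ if $g(rx)=r^sg(x)$ for all $x\in\mathbb R^n$ and $r>0$. Homogeneous dominance assumption. There exist a real $d\ge1$, constants $\delta,L>0$, and a continuous $d$-homogeneous vector field $f_d$ such that the origin of $\dot x=f_d(x)$ is locally asymptotically stable and, in a neighborhood of the origin, $f(x)=f_d(x)+r_f(x)$ with $\|r_f(x)\|\le L\|x\|^{d+\delta}$. Local Lyapunov function. Fix $p>1$, $\mu>0$ and a positive definite, proper (compact sublevel sets), $p$-homogeneous function $V_p\in C^1(\mathbb R^n)\cap C^\infty(\mathbb R^n\setminus\{0\})$ with $DV_p(x)f_d(x)\le-\mu\|x\|^{p+d-1}$ for $x\ne0$ (such $V_p$ exists by Rosier's homogeneous converse Lyapunov theorem). The network has at least one hidden layer, componentwise tanh activations and an affine output layer; $\theta$ is the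 vector of all weights and biases. A $C^1$ function $V$ is a strict Lyapunov function on a neighborhood $S$ of $0$ if $V(0)=0$, $V>0$ on $S\setminus\{0\}$, and $\mathcal L_fV<0$ on $S\setminus\{0\}$. *)

theory Defs
  imports "HOL-Analysis.Analysis"
begin

text \<open>
  \<open>Ck_on k S f\<close> is intended for an open set \<open>S\<close> in a finite-dimensional space; there it says that
  \<open>f\<close> is \<open>k\<close> times continuously differentiable on \<open>S\<close>, because continuity of all directional
  components \<open>x \<mapsto> Df(x) v\<close> is continuity of \<open>Df\<close>.
\<close>

primrec Ck_on ::
  "nat \<Rightarrow> 'a::euclidean_space set \<Rightarrow> ('a \<Rightarrow> 'b::real_normed_vector) \<Rightarrow> bool" where
  "Ck_on 0 S f \<longleftrightarrow> continuous_on S f"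
| "Ck_on (Suc k) S f \<longleftrightarrow>
     (\<forall>x\<in>S. f differentiable at x) \<and> (\<forall>v. Ck_on k S (\<lambda>x. frechet_derivative f (at x) v))"

definition smooth_on ::
  "'a::euclidean_space set \<Rightarrow> ('a \<Rightarrow> 'b::real_normed_vector) \<Rightarrow> bool" where
  "smooth_on S f \<longleftrightarrow> (\<forall>k. Ck_on k S f)"

definition lie_derivative ::
  "('a::euclidean_space \<Rightarrow> 'a) \<Rightarrow> ('a \<Rightarrow> real) \<Rightarrow> 'a \<Rightarrow> real" where
  "lie_derivative f V x = frechet_derivative V (at x) (f x)"

definition homogeneous ::
  "real \<Rightarrow> ('a::real_vector \<Rightarrow> 'b::real_vector) \<Rightarrow> bool" where
  "homogeneous s g \<longleftrightarrow> (\<forall>x. \<forall>r>0. g (r *\<^sub>R x) = (r powr s) *\<^sub>R g x)"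

definition solution_on ::
  "real set \<Rightarrow> ('a::real_normed_vector \<Rightarrow> 'a) \<Rightarrow> (real \<Rightarrow> 'a) \<Rightarrow> bool" where
  "solution_on J f \<phi> \<longleftrightarrow> (\<forall>t\<in>J. (\<phi> has_vector_derivative f (\<phi> t)) (at t within J))"

text \<open>
  The vector field is only continuous in the application, so initial value problems may have
  several solutions; all of them are required to stay close and to converge. Stability is imposed
  on solutions over arbitrary bounded intervals \<open>[0, T)\<close>. A solution that starts close to the
  origin therefore cannot blow up and extends to \<open>[0, \<infinity>)\<close>.
\<close>

definition origin_locally_asymptotically_stable ::
  "('a::euclidean_space \<Rightarrow> 'a) \<Rightarrow> bool" where
  "origin_locally_asymptotically_stable f \<longleftrightarrow>
     f 0 = 0 \<and>
     (\<forall>\<epsilon>>0. \<exists>\<eta>>0. \<forall>T>0. \<forall>\<phi>. solution_on {0..<T} f \<phi> \<and> norm (\<phi> 0) < \<eta> \<longrightarrow>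
        (\<forall>t\<in>{0..<T}. norm (\<phi> t) < \<epsilon>)) \<and>
     (\<exists>\<eta>>0. \<forall>\<phi>. solution_on {0..} f \<phi> \<and> norm (\<phi> 0) < \<eta> \<longrightarrow> (\<phi> \<longlongrightarrow> 0) at_top)"

definition homogeneous_dominance ::
  "('a::euclidean_space \<Rightarrow> 'a) \<Rightarrow> real \<Rightarrow> real \<Rightarrow> real \<Rightarrow> ('a \<Rightarrow> 'a) \<Rightarrow> bool" where
  "homogeneous_dominance f d \<delta> L f\<^sub>d \<longleftrightarrow>
     d \<ge> 1 \<and> \<delta> > 0 \<and> L > 0 \<and>
     continuous_on UNIV f\<^sub>d \<and> homogeneous d f\<^sub>d \<and>
     origin_locally_asymptotically_stable f\<^sub>d \<and>
     (\<exists>r\<^sub>f. \<forall>\<^sub>F x in nhds 0.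
        f x = f\<^sub>d x + r\<^sub>f x \<and> norm (r\<^sub>f x) \<le> L * norm x powr (d + \<delta>))"

definition positive_definite :: "('a::euclidean_space \<Rightarrow> real) \<Rightarrow> bool" where
  "positive_definite V \<longleftrightarrow> V 0 = 0 \<and> (\<forall>x. x \<noteq> 0 \<longrightarrow> V x > 0)"

definition proper_fun :: "('a::euclidean_space \<Rightarrow> real) \<Rightarrow> bool" where
  "proper_fun V \<longleftrightarrow> (\<forall>c. compact {x. V x \<le> c})"

definition strict_lyapunov_on ::
  "'a::euclidean_space set \<Rightarrow> ('a \<Rightarrow> 'a) \<Rightarrow> ('a \<Rightarrow> real) \<Rightarrow> bool" where
  "strict_lyapunov_on S f V \<longleftrightarrow>
     0 \<in> interior S \<and> Ck_on 1 UNIV V \<and> V 0 = 0 \<and>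
     (\<forall>x\<in>S - {0}. V x > 0) \<and> (\<forall>x\<in>S - {0}. lie_derivative f V x < 0)"

text \<open>
  An architecture is the list \<open>ms\<close> of hidden-layer widths. Hidden layer \<open>l < length ms\<close> has neurons
  \<open>i < ms ! l\<close>. Row \<open>i\<close> of the first weight matrix is \<open>in_weight \<theta> i\<close>, and \<open>weight \<theta> l i j\<close> is
  the weight from neuron \<open>j\<close> of hidden layer \<open>l - 1\<close> to neuron \<open>i\<close> of hidden layer \<open>l \<ge> 1\<close>.
  Entries with indices outside the architecture do not affect the network, so the records \<open>\<theta>\<close>
  cover exactly the parameter vectors of every architecture.
\<close>

record 'n net_params =
  in_weight :: "nat \<Rightarrow> real ^ 'n"
  weight :: "nat \<Rightarrow> nat \<Rightarrow> nat \<Rightarrow> real"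
  bias :: "nat \<Rightarrow> nat \<Rightarrow> real"
  out_weight :: "nat \<Rightarrow> real"
  out_bias :: real

definition architecture :: "nat list \<Rightarrow> bool" where
  "architecture ms \<longleftrightarrow> ms \<noteq> [] \<and> (\<forall>m\<in>set ms. m > 0)"

primrec hidden_layer ::
  "nat list \<Rightarrow> 'n::finite net_params \<Rightarrow> nat \<Rightarrow> real ^ 'n \<Rightarrow> nat \<Rightarrow> real" where
  "hidden_layer ms \<theta> 0 x i = tanh (in_weight \<theta> i \<bullet> x + bias \<theta> 0 i)"
| "hidden_layer ms \<theta> (Suc l) x i =
     tanh ((\<Sum>j<ms ! l. weight \<theta> (Suc l) i j * hidden_layer ms \<theta> l x j) + bias \<theta> (Suc l) i)"

definition network ::
  "nat list \<Rightarrow> 'n::finite net_params \<Rightarrow> real ^ 'n \<Rightarrow> real" where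
  "network ms \<theta> x =
     (\<Sum>j<last ms. out_weight \<theta> j * hidden_layer ms \<theta> (length ms - 1) x j) + out_bias \<theta>"

definition G_net ::
  "nat list \<Rightarrow> 'n::finite net_params \<Rightarrow> real ^ 'n \<Rightarrow> real" where
  "G_net ms \<theta> x = network ms \<theta> x - network ms \<theta> 0"

definition H_net ::
  "(real ^ 'n \<Rightarrow> real) \<Rightarrow> nat list \<Rightarrow> 'n::finite net_params \<Rightarrow> real ^ 'n \<Rightarrow> real" where
  "H_net V ms \<theta> x = V x * exp (G_net ms \<theta> x)"

definition W_net ::
  "(real ^ 'n \<Rightarrow> real) \<Rightarrow> nat list \<Rightarrow> 'n::finite net_params \<Rightarrow> real ^ 'n \<Rightarrow> real" where
  "W_net V ms \<theta> x = tanh (H_net V ms \<theta> x)"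

end

theory Submission imports Defs begin

text \<open>
  Since \<open>D(V e\<^sup>G) f = e\<^sup>G (DV f\<^sub>d + DV r\<^sub>f + V DG f)\<close>, it suffices to compare orders at the origin.
  The first term is at most \<open>- \<mu> \<parallel>x\<parallel>\<close> to the power \<open>p + d - 1\<close>. As \<open>DV\<close> is homogeneous of
  degree \<open>p - 1\<close>, the second one has order \<open>p + d - 1 + \<delta>\<close>; as \<open>DG\<close> is locally bounded, the third
  one has order \<open>p + d\<close>. Composing with \<open>tanh\<close> only multiplies the Lie derivative by the
  positive factor \<open>1 - tanh\<^sup>2 H\<close>.
\<close>

section \<open>Calculus of C^1 functions on the whole space\<close>

text \<open>Allows any explicit derivative to serve as a witness in the closure lemmas below: by
  uniqueness of derivatives it coincides with \<open>frechet_derivative\<close>.\<close>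

lemma Ck_on_1_iff:
  fixes g :: "'a::euclidean_space \<Rightarrow> 'b::real_normed_vector"
  shows "Ck_on 1 UNIV g \<longleftrightarrow>
    (\<exists>g'. (\<forall>x. (g has_derivative g' x) (at x)) \<and> (\<forall>v. continuous_on UNIV (\<lambda>x. g' x v)))"
proof
  assume "Ck_on 1 UNIV g"
  then show "\<exists>g'. (\<forall>x. (g has_derivative g' x) (at x)) \<and> (\<forall>v. continuous_on UNIV (\<lambda>x. g' x v))"
    by (intro exI[of _ "\<lambda>x. frechet_derivative g (at x)"]) (simp add: frechet_derivative_works)
next
  assume "\<exists>g'. (\<forall>x. (g has_derivative g' x) (at x)) \<and> (\<forall>v. continuous_on UNIV (\<lambda>x. g' x v))"
  then obtain g' where g': "\<And>x. (g has_derivative g' x) (at x)"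
    and cont: "\<And>v. continuous_on UNIV (\<lambda>x. g' x v)"
    by blast
  have "frechet_derivative g (at x) = g' x" for x
    using frechet_derivative_at[OF g'] by simp
  then show "Ck_on 1 UNIV g"
    using g' cont by (auto simp: differentiable_def)
qed

lemma Ck_on_1_has_derivative:
  "Ck_on 1 UNIV g \<Longrightarrow> (g has_derivative frechet_derivative g (at x)) (at x)"
  by (simp add: frechet_derivative_works)

lemma Ck_on_1_continuous_derivative:
  "Ck_on 1 UNIV g \<Longrightarrow> continuous_on A (\<lambda>x. frechet_derivative g (at x) v)"
  by (auto intro: continuous_on_subset)

lemma Ck_on_1_continuous_on:
  "Ck_on 1 UNIV g \<Longrightarrow> continuous_on A g"
  by (meson Ck_on_1_has_derivative continuous_at_imp_continuous_on has_derivative_continuous)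

lemma Ck_on_1_const: "Ck_on 1 UNIV (\<lambda>x. c)"
  unfolding Ck_on_1_iff by (intro exI[of _ "\<lambda>_ _. 0"]) auto

lemma Ck_on_1_inner_left: "Ck_on 1 UNIV (\<lambda>x. a \<bullet> x)"
  unfolding Ck_on_1_iff by (intro exI[of _ "\<lambda>_ v. a \<bullet> v"]) (auto intro!: derivative_eq_intros)

lemma Ck_on_1_add:
  assumes "Ck_on 1 UNIV g" "Ck_on 1 UNIV h"
  shows "Ck_on 1 UNIV (\<lambda>x. g x + h x)"
  using assms unfolding Ck_on_1_iff
  by (fast intro: has_derivative_add continuous_on_add)

lemma Ck_on_1_mult:
  fixes g h :: "'a::euclidean_space \<Rightarrow> real"
  assumes "Ck_on 1 UNIV g" "Ck_on 1 UNIV h"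
  shows "Ck_on 1 UNIV (\<lambda>x. g x * h x)"
  unfolding Ck_on_1_iff
  by (intro exI[of _ "\<lambda>x v. g x * frechet_derivative h (at x) v + frechet_derivative g (at x) v * h x"]
      conjI allI has_derivative_mult continuous_intros
      Ck_on_1_has_derivative Ck_on_1_continuous_derivative Ck_on_1_continuous_on assms)

lemma Ck_on_1_sum:
  assumes "\<And>i. i \<in> I \<Longrightarrow> Ck_on 1 UNIV (g i)"
  shows "Ck_on 1 UNIV (\<lambda>x. \<Sum>i\<in>I. g i x)"
  using assms by (induction I rule: infinite_finite_induct)
    (auto simp del: Ck_on.simps One_nat_def intro: Ck_on_1_const Ck_on_1_add)

lemma Ck_on_1_compose_real:
  fixes g :: "'a::euclidean_space \<Rightarrow> real"
  assumes g: "Ck_on 1 UNIV g"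
    and \<sigma>: "\<And>y. (\<sigma> has_real_derivative \<sigma>' y) (at y)" "continuous_on UNIV \<sigma>'"
  shows "Ck_on 1 UNIV (\<lambda>x. \<sigma> (g x))"
proof -
  have "((\<lambda>x. \<sigma> (g x)) has_derivative (\<lambda>v. \<sigma>' (g x) * frechet_derivative g (at x) v)) (at x)" for x
    using has_derivative_compose[OF Ck_on_1_has_derivative[OF g] \<sigma>(1)[unfolded has_field_derivative_def]]
    by simp
  moreover have "continuous_on UNIV (\<lambda>x. \<sigma>' (g x))"
    using continuous_on_compose2[OF \<sigma>(2) Ck_on_1_continuous_on[OF g]] by simp
  ultimately show ?thesis
    unfolding Ck_on_1_iff
    by (intro exI[of _ "\<lambda>x v. \<sigma>' (g x) * frechet_derivative g (at x) v"])
      (use Ck_on_1_continuous_derivative[OF g] in \<open>auto intro!: continuous_on_mult\<close>)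
qed

lemma has_real_derivative_tanh: "(tanh has_real_derivative 1 - tanh y ^ 2) (at (y::real))"
  by (auto intro!: derivative_eq_intros)

lemma Ck_on_1_tanh:
  fixes g :: "'a::euclidean_space \<Rightarrow> real"
  assumes "Ck_on 1 UNIV g"
  shows "Ck_on 1 UNIV (\<lambda>x. tanh (g x))"
  by (rule Ck_on_1_compose_real[OF assms has_real_derivative_tanh]) (auto intro!: continuous_intros)

lemma Ck_on_1_exp:
  fixes g :: "'a::euclidean_space \<Rightarrow> real"
  assumes "Ck_on 1 UNIV g"
  shows "Ck_on 1 UNIV (\<lambda>x. exp (g x))"
  by (rule Ck_on_1_compose_real[OF assms DERIV_exp]) (auto intro!: continuous_intros)

section \<open>Regularity of the network\<close>

text \<open>Induction over the layers; \<open>i\<close> is generalized because each neuron sums over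
  all neurons of the previous layer.\<close>

lemma Ck_on_1_hidden_layer: "Ck_on 1 UNIV (\<lambda>x. hidden_layer ms \<theta> l x i)"
  by (induction l arbitrary: i)
    (simp_all only: hidden_layer.simps Ck_on_1_tanh Ck_on_1_add Ck_on_1_sum Ck_on_1_mult
      Ck_on_1_const Ck_on_1_inner_left)

lemma Ck_on_1_G_net: "Ck_on 1 UNIV (G_net ms \<theta>)"
proof -
  have "G_net ms \<theta> = (\<lambda>x. network ms \<theta> x + - network ms \<theta> 0)"
    by (simp add: fun_eq_iff G_net_def)
  moreover have "Ck_on 1 UNIV (network ms \<theta>)"
    unfolding network_def
    by (intro Ck_on_1_add Ck_on_1_sum Ck_on_1_mult Ck_on_1_const Ck_on_1_hidden_layer)
  ultimately show ?thesis
    by (simp only: Ck_on_1_add Ck_on_1_const)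
qed

section \<open>Lie derivatives under the two transformations\<close>

text \<open>Product and chain rule, with the positive factor \<open>exp (G x)\<close> pulled out so
  that the bracket alone decides the sign.\<close>

lemma lie_derivative_mult_exp:
  assumes "Ck_on 1 UNIV V" "Ck_on 1 UNIV G"
  shows "lie_derivative f (\<lambda>x. V x * exp (G x)) x
    = exp (G x) * (lie_derivative f V x + V x * lie_derivative f G x)"
proof -
  have "((\<lambda>x. V x * exp (G x)) has_derivative (\<lambda>v. V x * (frechet_derivative G (at x) v * exp (G x))
      + frechet_derivative V (at x) v * exp (G x))) (at x)"
    by (intro has_derivative_mult has_derivative_exp Ck_on_1_has_derivative assms)
  from frechet_derivative_at[OF this, symmetric] show ?thesis
    by (simp add: lie_derivative_def algebra_simps)
qed

lemma lie_derivative_tanh: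
  assumes "Ck_on 1 UNIV V"
  shows "lie_derivative f (\<lambda>x. tanh (V x)) x = (1 - tanh (V x) ^ 2) * lie_derivative f V x"
proof -
  have "((\<lambda>x. tanh (V x)) has_derivative (\<lambda>v. (1 - tanh (V x) ^ 2) * frechet_derivative V (at x) v)) (at x)"
    using has_derivative_compose[OF Ck_on_1_has_derivative[OF assms]
        has_real_derivative_tanh[unfolded has_field_derivative_def]]
    by simp
  from frechet_derivative_at[OF this, symmetric] show ?thesis
    by (simp add: lie_derivative_def)
qed

text \<open>\<open>tanh\<close> is C^1, vanishes at 0, preserves positivity and has positive slope,
  so the same neighborhood serves.\<close>

lemma strict_lyapunov_on_tanh:
  assumes "strict_lyapunov_on S f V"
  shows "strict_lyapunov_on S f (\<lambda>x. tanh (V x))"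
proof -
  have "tanh y ^ 2 < 1" for y :: real
    unfolding abs_square_less_1 abs_less_iff
    using tanh_real_gt_neg1[of y] tanh_real_lt_1[of y] by linarith
  then show ?thesis
    using assms unfolding strict_lyapunov_on_def
    by (auto simp: lie_derivative_tanh mult_pos_neg simp del: Ck_on.simps One_nat_def intro: Ck_on_1_tanh)
qed

section \<open>Growth bounds for homogeneous functions and for derivatives\<close>

text \<open>A bound on the compact unit sphere is carried along rays by homogeneity. The origin is
  left out: \<open>0 powr s\<close> is 0 even for \<open>s = 0\<close>, where \<open>g 0\<close> may
  be nonzero.\<close>

lemma homogeneous_bound:
  fixes g :: "'a::euclidean_space \<Rightarrow> 'b::real_normed_vector"
  assumes hom: "homogeneous s g" and cont: "continuous_on (sphere 0 1) g"
  obtains C where "\<And>x. x \<noteq> 0 \<Longrightarrow> norm (g x) \<le> C * norm x powr s"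
proof -
  have "bounded (g ` sphere 0 1)"
    using compact_continuous_image[OF cont] compact_imp_bounded by auto
  then obtain C where C: "\<And>y. y \<in> sphere 0 1 \<Longrightarrow> norm (g y) \<le> C"
    unfolding bounded_iff by blast
  have "norm (g x) \<le> C * norm x powr s" if "x \<noteq> 0" for x
  proof -
    \<comment> \<open>\<open>sgn x\<close> is the radial projection of \<open>x\<close> to the unit
      sphere.\<close>
    have "g x = (norm x powr s) *\<^sub>R g (sgn x)"
      using hom[unfolded homogeneous_def, rule_format, of "norm x" "sgn x"] that
      by (simp add: sgn_div_norm)
    then show ?thesis
      using mult_left_mono[OF C[of "sgn x"], of "norm x powr s"] that
      by (simp add: norm_sgn mult.commute)
  qed
  then show ?thesis by (rule that)
qed

text \<open>Differentiating \<open>V (r x) = r powr p * V x\<close> in \<open>x\<close> in two ways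
  and using linearity in \<open>v\<close> leaves one factor \<open>r\<close> to cancel.\<close>

lemma homogeneous_frechet_derivative:
  assumes hom: "homogeneous p V" and V: "Ck_on 1 UNIV V"
  shows "homogeneous (p - 1) (\<lambda>x. frechet_derivative V (at x) v)"
  unfolding homogeneous_def
proof (intro allI impI)
  fix x :: 'a and r :: real assume r: "r > 0"
  let ?D = "\<lambda>x. frechet_derivative V (at x)"
  have "((\<lambda>y. V (r *\<^sub>R y)) has_derivative (\<lambda>v. ?D (r *\<^sub>R x) (r *\<^sub>R v))) (at x)"
    by (rule has_derivative_compose[OF _ Ck_on_1_has_derivative[OF V]])
      (auto intro!: derivative_eq_intros)
  moreover have "(\<lambda>y. V (r *\<^sub>R y)) = (\<lambda>y. (r powr p) *\<^sub>R V y)"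
    using hom r by (auto simp: homogeneous_def)
  moreover have "((\<lambda>y. (r powr p) *\<^sub>R V y) has_derivative (\<lambda>v. (r powr p) *\<^sub>R ?D x v)) (at x)"
    by (intro has_derivative_scaleR_right Ck_on_1_has_derivative V)
  ultimately have "?D (r *\<^sub>R x) (r *\<^sub>R v) = (r powr p) *\<^sub>R ?D x v"
    by (metis has_derivative_unique)
  moreover have "?D (r *\<^sub>R x) (r *\<^sub>R v) = r *\<^sub>R ?D (r *\<^sub>R x) v"
    using Ck_on_1_has_derivative[OF V] has_derivative_linear linear_scale by blast
  ultimately have "inverse r *\<^sub>R r *\<^sub>R ?D (r *\<^sub>R x) v = inverse r *\<^sub>R (r powr p) *\<^sub>R ?D x v"
    by simp
  then show "?D (r *\<^sub>R x) v = (r powr (p - 1)) *\<^sub>R ?D x v"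
    using r by (simp add: powr_diff divide_inverse mult.commute)
qed

text \<open>Replaces the operator norm: \<open>Ck_on\<close> controls the derivative one direction
  at a time, and finitely many basis directions then give a bound uniform in
  \<open>v\<close>.\<close>

lemma linear_bound_Basis:
  fixes g :: "'a::euclidean_space \<Rightarrow> 'b::real_normed_vector"
  assumes "linear g"
  shows "norm (g v) \<le> (\<Sum>b\<in>Basis. norm (g b)) * norm v"
proof -
  have "g v = (\<Sum>b\<in>Basis. (v \<bullet> b) *\<^sub>R g b)"
    by (metis (mono_tags, lifting) assms euclidean_representation linear_scale linear_sum sum.cong)
  also have "norm \<dots> \<le> (\<Sum>b\<in>Basis. norm (g b) * norm v)"
    by (rule sum_norm_le) (simp add: Basis_le_norm mult.commute[of _ "norm (g _)"] mult_left_mono)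
  finally show ?thesis
    by (simp add: sum_distrib_right)
qed

text \<open>Each partial derivative is homogeneous of degree \<open>p - 1\<close> and continuous,
  hence bounded by \<open>homogeneous_bound\<close>; the constants for the basis directions are
  summed.\<close>

lemma homogeneous_derivative_bound:
  assumes hom: "homogeneous p V" and V: "Ck_on 1 UNIV V"
  obtains M where "\<And>x v. x \<noteq> 0 \<Longrightarrow> norm (frechet_derivative V (at x) v) \<le> M * norm x powr (p - 1) * norm v"
proof -
  let ?D = "\<lambda>x. frechet_derivative V (at x)"
  have "\<exists>C. \<forall>x. x \<noteq> 0 \<longrightarrow> norm (?D x b) \<le> C * norm x powr (p - 1)" for b
    using homogeneous_bound[OF homogeneous_frechet_derivative[OF hom V] Ck_on_1_continuous_derivative[OF V]]
    by metis
  then obtain C where C: "\<And>b x. x \<noteq> 0 \<Longrightarrow> norm (?D x b) \<le> C b * norm x powr (p - 1)"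
    by metis
  have "norm (?D x v) \<le> (\<Sum>b\<in>Basis. C b) * norm x powr (p - 1) * norm v" if "x \<noteq> 0" for x v
  proof -
    have "norm (?D x v) \<le> (\<Sum>b\<in>Basis. norm (?D x b)) * norm v"
      using linear_bound_Basis has_derivative_linear Ck_on_1_has_derivative[OF V] by blast
    also have "\<dots> \<le> (\<Sum>b\<in>Basis. C b * norm x powr (p - 1)) * norm v"
      by (intro mult_right_mono sum_mono C that) simp
    finally show ?thesis by (simp add: sum_distrib_right)
  qed
  then show ?thesis by (rule that)
qed

lemma derivative_bound_compact:
  assumes G: "Ck_on 1 UNIV G" and A: "compact A"
  obtains B where "\<And>x v. x \<in> A \<Longrightarrow> norm (frechet_derivative G (at x) v) \<le> B * norm v"
proof -
  let ?D = "\<lambda>x. frechet_derivative G (at x)"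
  have "continuous_on A (\<lambda>x. \<Sum>b\<in>Basis. norm (?D x b))"
    by (intro continuous_intros Ck_on_1_continuous_derivative G)
  then have "bounded ((\<lambda>x. \<Sum>b\<in>Basis. norm (?D x b)) ` A)"
    using A compact_continuous_image compact_imp_bounded by blast
  then obtain B where B: "\<And>x. x \<in> A \<Longrightarrow> (\<Sum>b\<in>Basis. norm (?D x b)) \<le> B"
    unfolding bounded_iff by (metis abs_le_D1 imageI real_norm_def)
  have "norm (?D x v) \<le> B * norm v" if "x \<in> A" for x v
    using linear_bound_Basis[OF has_derivative_linear[OF Ck_on_1_has_derivative[OF G]], of x v]
      mult_right_mono[OF B[OF that], of "norm v"] by simp
  then show ?thesis by (rule that)
qed

section \<open>The estimate near the origin\<close>

text \<open>Stated for any C^1 exponent \<open>G\<close>, since C^1 regularity is all that enters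
  about the network.\<close>

lemma strict_lyapunov_on_mult_exp:
  fixes f f\<^sub>d :: "'a::euclidean_space \<Rightarrow> 'a"
  assumes dom: "homogeneous_dominance f d \<delta> L f\<^sub>d"
    and \<mu>: "\<mu> > 0"
    and pd: "positive_definite V" and hom: "homogeneous p V" and V: "Ck_on 1 UNIV V"
    and decay: "\<And>x. x \<noteq> 0 \<Longrightarrow> lie_derivative f\<^sub>d V x \<le> - \<mu> * norm x powr (p + d - 1)"
    and G: "Ck_on 1 UNIV G"
  obtains S where "strict_lyapunov_on S f (\<lambda>x. V x * exp (G x))"
proof -
  from dom have \<delta>: "\<delta> > 0" and L: "L > 0"
    and f\<^sub>d: "continuous_on UNIV f\<^sub>d" "homogeneous d f\<^sub>d"
    by (auto simp: homogeneous_dominance_def)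
  obtain r where r: "\<forall>\<^sub>F x in nhds 0. f x = f\<^sub>d x + r x \<and> norm (r x) \<le> L * norm x powr (d + \<delta>)"
    using dom by (auto simp: homogeneous_dominance_def)
  obtain F where F: "\<And>x. x \<noteq> 0 \<Longrightarrow> norm (f\<^sub>d x) \<le> F * norm x powr d"
    using homogeneous_bound[OF f\<^sub>d(2) continuous_on_subset[OF f\<^sub>d(1)]] by blast
  obtain K where K: "\<And>x. x \<noteq> 0 \<Longrightarrow> norm (V x) \<le> K * norm x powr p"
    using homogeneous_bound[OF hom Ck_on_1_continuous_on[OF V]] by blast
  obtain M where M: "\<And>x v. x \<noteq> 0 \<Longrightarrow>
      norm (frechet_derivative V (at x) v) \<le> M * norm x powr (p - 1) * norm v"
    using homogeneous_derivative_bound[OF hom V] by blast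
  obtain B where B: "\<And>x v. x \<in> cball 0 1 \<Longrightarrow> norm (frechet_derivative G (at x) v) \<le> B * norm v"
    using derivative_bound_compact[OF G compact_cball] by blast
  \<comment> \<open>The two perturbation terms divided by \<open>norm x powr (p + d - 1)\<close>:
    first the derivative of \<open>V\<close> along \<open>r\<close>, then \<open>V\<close> times the
    derivative of \<open>G\<close> along \<open>f\<close>. Both vanish at the origin, the first
    because \<delta> is positive.\<close>
  let ?q = "\<lambda>x::'a. M * L * norm x powr \<delta> + K * B * (F + L * norm x powr \<delta>) * norm x"
  have "((\<lambda>x. norm x powr \<delta>) \<longlongrightarrow> 0) (at (0::'a))"
    using \<delta> by (auto intro!: tendsto_eq_intros tendsto_norm_zero)
  then have "(?q \<longlongrightarrow> 0) (at 0)"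
    using \<delta> by (auto intro!: tendsto_eq_intros tendsto_norm_zero)
  then have "\<forall>\<^sub>F x in at 0. ?q x < \<mu>"
    using \<mu> by (rule order_tendstoD)
  then have "\<forall>\<^sub>F x in nhds 0. x \<noteq> 0 \<longrightarrow> ?q x < \<mu>"
    by (simp add: eventually_at_filter)
  \<comment> \<open>Keeps \<open>x\<close> in the compact unit ball on which \<open>B\<close> bounds
    the derivative of \<open>G\<close>.\<close>
  moreover have "\<forall>\<^sub>F x in nhds 0. x \<in> ball (0::'a) 1"
    by (rule eventually_nhds_in_open) auto
  ultimately have "\<forall>\<^sub>F x in nhds 0. (x \<noteq> 0 \<longrightarrow> ?q x < \<mu>) \<and> x \<in> ball 0 1 \<and>
      f x = f\<^sub>d x + r x \<and> norm (r x) \<le> L * norm x powr (d + \<delta>)"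
    using r by eventually_elim auto
  then obtain S where S: "open S" "0 \<in> S" and near: "\<And>x. x \<in> S \<Longrightarrow> (x \<noteq> 0 \<longrightarrow> ?q x < \<mu>) \<and>
      x \<in> ball 0 1 \<and> f x = f\<^sub>d x + r x \<and> norm (r x) \<le> L * norm x powr (d + \<delta>)"
    unfolding eventually_nhds by auto
  have "lie_derivative f V x + V x * lie_derivative f G x < 0" if x: "x \<in> S" "x \<noteq> 0" for x
  proof -
    let ?n = "norm x"
    have n: "?n > 0" using x by simp
    note nx = near[OF x(1)]
    \<comment> \<open>The constants were obtained without a sign. Here and for \<open>B\<close>,
      nonnegativity is read off from the bound itself, which dominates a norm.\<close>
    have "M * ?n powr (p - 1) * norm x \<ge> 0"
      by (rule order_trans[OF norm_ge_zero M[OF x(2)]])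
    then have M0: "M * ?n powr (p - 1) \<ge> 0"
      using n by (simp add: zero_le_mult_iff)
    have "B * norm x \<ge> 0"
      by (rule order_trans[OF norm_ge_zero B[of x]]) (use nx in auto)
    then have B0: "B \<ge> 0"
      using n by (simp add: zero_le_mult_iff)
    have "lie_derivative f V x = lie_derivative f\<^sub>d V x + frechet_derivative V (at x) (r x)"
      using nx by (simp add: lie_derivative_def
          linear_add[OF has_derivative_linear[OF Ck_on_1_has_derivative[OF V]]])
    moreover have "frechet_derivative V (at x) (r x) \<le> M * ?n powr (p - 1) * (L * ?n powr (d + \<delta>))"
      using abs_le_D1[OF M[OF x(2), of "r x", unfolded real_norm_def]] nx
        mult_left_mono[OF _ M0, of "norm (r x)"] by (meson order_trans)
    ultimately have 1: "lie_derivative f V x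
        \<le> - \<mu> * ?n powr (p + d - 1) + M * ?n powr (p - 1) * (L * ?n powr (d + \<delta>))"
      using decay[OF x(2)] by linarith
    have "norm (f x) \<le> F * ?n powr d + L * ?n powr (d + \<delta>)"
      using nx F[OF x(2)] norm_triangle_ineq[of "f\<^sub>d x" "r x"] by auto
    then have "B * norm (f x) \<le> B * (F * ?n powr d + L * ?n powr (d + \<delta>))"
      using B0 mult_left_mono by blast
    then have "norm (lie_derivative f G x) \<le> B * (F * ?n powr d + L * ?n powr (d + \<delta>))"
      using B[of x "f x"] nx unfolding lie_derivative_def by auto
    then have "norm (V x) * norm (lie_derivative f G x)
        \<le> (K * ?n powr p) * (B * (F * ?n powr d + L * ?n powr (d + \<delta>)))"
      by (intro mult_mono K x(2)) (auto intro: order_trans[OF norm_ge_zero K[OF x(2)]])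
    then have 2: "V x * lie_derivative f G x
        \<le> (K * ?n powr p) * (B * (F * ?n powr d + L * ?n powr (d + \<delta>)))"
      unfolding real_norm_def abs_mult[symmetric] by (rule abs_le_D1)
    \<comment> \<open>Every term carries the common power \<open>p + d - 1\<close>; the surplus
      powers are those collected in \<open>?q\<close>.\<close>
    have "lie_derivative f V x + V x * lie_derivative f G x \<le> (?q x - \<mu>) * ?n powr (p + d - 1)"
    proof -
      have "?n powr (p - 1) * ?n powr (d + \<delta>) = ?n powr (p + d - 1) * ?n powr \<delta>"
        by (simp add: powr_add[symmetric] algebra_simps)
      moreover have n_powr: "?n powr p * ?n powr d = ?n powr (p + d - 1) * ?n"
        using n by (simp add: powr_add powr_diff)
      moreover have "?n powr p * ?n powr (d + \<delta>) = ?n powr (p + d - 1) * ?n * ?n powr \<delta>"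
        using n_powr by (simp add: powr_add)
      \<comment> \<open>With the powers of the norm as atoms, both identities follow from the three
        product rules by ring arithmetic.\<close>
      ultimately have eqs: "M * ?n powr (p - 1) * (L * ?n powr (d + \<delta>))
          = M * L * ?n powr \<delta> * ?n powr (p + d - 1)"
        "(K * ?n powr p) * (B * (F * ?n powr d + L * ?n powr (d + \<delta>)))
          = K * B * (F + L * ?n powr \<delta>) * ?n * ?n powr (p + d - 1)"
        by algebra+
      show ?thesis
        using 1 2 unfolding eqs by (simp add: algebra_simps)
    qed
    also have "\<dots> < 0"
      using nx x n by (simp add: mult_neg_pos)
    finally show ?thesis .
  qed
  then have "strict_lyapunov_on S f (\<lambda>x. V x * exp (G x))"
    using S pd V G unfolding strict_lyapunov_on_def positive_definite_def
    by (auto simp: lie_derivative_mult_exp interior_open mult_pos_neg simp del: Ck_on.simps One_nat_def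
        intro!: Ck_on_1_mult Ck_on_1_exp)
  then show ?thesis by (rule that)
qed

section \<open>Application to the network functions\<close>

theorem proposition9:
  fixes f f\<^sub>d :: "real ^ 'n::finite \<Rightarrow> real ^ 'n"
    and V\<^sub>p :: "real ^ 'n \<Rightarrow> real"
    and d \<delta> L p \<mu> :: real
    and ms :: "nat list"
    and \<theta> :: "'n net_params"
  assumes "Ck_on 1 UNIV f" and "f 0 = 0"
    and "homogeneous_dominance f d \<delta> L f\<^sub>d"
    and "p > 1" and "\<mu> > 0"
    and "positive_definite V\<^sub>p" and "proper_fun V\<^sub>p" and "homogeneous p V\<^sub>p"
    and "Ck_on 1 UNIV V\<^sub>p" and "smooth_on (UNIV - {0}) V\<^sub>p"
    and "\<And>x. x \<noteq> 0 \<Longrightarrow> lie_derivative f\<^sub>d V\<^sub>p x \<le> - \<mu> * norm x powr (p + d - 1)"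
    and "architecture ms"
  shows "\<exists>S. strict_lyapunov_on S f (H_net V\<^sub>p ms \<theta>) \<and> strict_lyapunov_on S f (W_net V\<^sub>p ms \<theta>)"
proof -
  obtain S where "strict_lyapunov_on S f (H_net V\<^sub>p ms \<theta>)"
    using strict_lyapunov_on_mult_exp[OF assms(3,5,6,8,9,11) Ck_on_1_G_net]
    unfolding H_net_def by blast
  moreover from this have "strict_lyapunov_on S f (W_net V\<^sub>p ms \<theta>)"
    unfolding W_net_def by (rule strict_lyapunov_on_tanh)
  ultimately show ?thesis by blast
qed

end
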